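(* Let $n\ge 1$ and let $G$ be a unit rectangle visibility graph with $n$ vertices. Then $$|E(G)|\le 6n-4\lceil\sqrt{n}\,\rceil+1.$$
   Context: A finite simple graph $G$ is a unit rectangle visibility graph (URVG) if its vertices $v$ can be represented by closed unit squares $S_v$ in the plane with sides parallel to the coordinate axes and with pairwise disjoint interiors (squares may touch along their boundaries), in such a way that two distinct vertices $v,w$ are adjacent if and only if there is an unobstructed non-degenerate (positive width) horizontal or vertical band of visibility joining $S_v$ and $S_w$. Here a horizontal band of visibility joining $S_v$ and $S_w$ is given by an open interval $I$ of positive length such that for every $y_0\in I$ the line $y=y_0$ meets the interiors of both $S_v$ and $S_w$, and the part of this line between $S_v$ and $S_w$ (possibly a single point if the squares touch) meets the interior of no other square of the representation; vertical bands are defined analogously with the roles of $x$ and $y$ exchanged. *)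

theory Defs
  imports "HOL-Analysis.Analysis"
begin

definition simple_graph :: "'a set \<Rightarrow> 'a set set \<Rightarrow> bool" where
  "simple_graph V E \<longleftrightarrow> finite V \<and> E \<subseteq> {e. e \<subseteq> V \<and> card e = 2}"

definition unit_square :: "(real \<times> real) set \<Rightarrow> bool" where
  "unit_square A \<longleftrightarrow> (\<exists>p. A = cbox p (p + (1, 1)))"

text \<open>
  The line meant below is the set of points whose \<open>g\<close>-coordinate is \<open>t\<close>, and \<open>f\<close> measures position
  along it: \<open>(f, g) = (fst, snd)\<close> gives horizontal lines and \<open>(f, g) = (snd, fst)\<close> vertical ones.
  When the line meets both of two squares with disjoint interiors, in their interiors,
  \<open>gap f g t A B\<close> is the closed segment of the line from one square to the other; it is a single
  point if they touch.
\<close>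

definition gap :: "(real \<times> real \<Rightarrow> real) \<Rightarrow> (real \<times> real \<Rightarrow> real) \<Rightarrow> real \<Rightarrow>
    (real \<times> real) set \<Rightarrow> (real \<times> real) set \<Rightarrow> (real \<times> real) set" where
  "gap f g t A B = {q. g q = t \<and>
     ((\<forall>a\<in>A. g a = t \<longrightarrow> f a \<le> f q) \<and> (\<forall>b\<in>B. g b = t \<longrightarrow> f q \<le> f b) \<or>
      (\<forall>b\<in>B. g b = t \<longrightarrow> f b \<le> f q) \<and> (\<forall>a\<in>A. g a = t \<longrightarrow> f q \<le> f a))}"

definition visibility_band :: "(real \<times> real \<Rightarrow> real) \<Rightarrow> (real \<times> real \<Rightarrow> real) \<Rightarrow>
    'a set \<Rightarrow> ('a \<Rightarrow> (real \<times> real) set) \<Rightarrow> 'a \<Rightarrow> 'a \<Rightarrow> bool" where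
  "visibility_band f g V S v w \<longleftrightarrow> (\<exists>c d. c < d \<and> (\<forall>t\<in>{c<..<d}.
     (\<exists>q\<in>interior (S v). g q = t) \<and>
     (\<exists>q\<in>interior (S w). g q = t) \<and>
     (\<forall>u\<in>V - {v, w}. gap f g t (S v) (S w) \<inter> interior (S u) = {})))"

abbreviation horizontal_band :: "'a set \<Rightarrow> ('a \<Rightarrow> (real \<times> real) set) \<Rightarrow> 'a \<Rightarrow> 'a \<Rightarrow> bool" where
  "horizontal_band \<equiv> visibility_band fst snd"

abbreviation vertical_band :: "'a set \<Rightarrow> ('a \<Rightarrow> (real \<times> real) set) \<Rightarrow> 'a \<Rightarrow> 'a \<Rightarrow> bool" where
  "vertical_band \<equiv> visibility_band snd fst"

definition urv_representation :: "'a set \<Rightarrow> 'a set set \<Rightarrow> ('a \<Rightarrow> (real \<times> real) set) \<Rightarrow> bool" where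
  "urv_representation V E S \<longleftrightarrow>
     (\<forall>v\<in>V. unit_square (S v)) \<and>
     disjoint_family_on (\<lambda>v. interior (S v)) V \<and>
     (\<forall>v\<in>V. \<forall>w\<in>V. v \<noteq> w \<longrightarrow>
        ({v, w} \<in> E \<longleftrightarrow> horizontal_band V S v w \<or> vertical_band V S v w))"

definition unit_rectangle_visibility_graph :: "'a set \<Rightarrow> 'a set set \<Rightarrow> bool" where
  "unit_rectangle_visibility_graph V E \<longleftrightarrow>
     simple_graph V E \<and> (\<exists>S. urv_representation V E S)"

end

theory Submission
  imports Defs
begin

text \<open>
  Sweep a horizontal line upwards over the squares and add the two points at infinity to every row.
  A pair of consecutive objects of a row is new only if the sweep has just reached the bottom of its
  left square, the bottom of its right square, or the top of a square that separated the two; each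
  of these events determines the pair. Apart from the empty row this gives at most \<open>3n\<close> pairs, even
  \<open>3n - 1\<close> because passing the highest top leaves an empty row. If \<open>a\<close> horizontal lines with pairwise
  distances at least 1 meet all squares, then at least \<open>2a\<close> of the pairs involve a point at infinity,
  so there are at most \<open>3n - 2a - 1\<close> horizontal adjacencies, and likewise at most \<open>3n - 2b - 1\<close>
  vertical ones. Every half-open square contains a crossing of a horizontal and a vertical line, and
  disjoint squares contain different ones, whence \<open>n \<le> ab\<close> and \<open>a + b \<ge> 2\<lceil>\<surd>n\<rceil> - 1\<close>.
\<close>

section \<open>Greedy stabbing of half-open unit intervals\<close>

text \<open>The largest left endpoint \<open>p\<close> stabs every interval starting above
  \<open>p - 1\<close>. The points for the remaining intervals are left endpoints of these, hence at
  most \<open>p - 1\<close>.\<close>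

lemma separated_stabbing_set:
  fixes y :: "'a \<Rightarrow> real"
  assumes "finite V"
  shows "\<exists>P. finite P \<and> P \<subseteq> y ` V \<and> (\<forall>v\<in>V. \<exists>p\<in>P. y v \<le> p \<and> p < y v + 1) \<and>
    (\<forall>p\<in>P. \<forall>q\<in>P. p \<noteq> q \<longrightarrow> 1 \<le> \<bar>p - q\<bar>)"
  using assms
proof (induction V rule: finite_psubset_induct)
  case (psubset V)
  show ?case
  proof (cases "V = {}")
    case True
    then show ?thesis by auto
  next
    case False
    define p where "p = Max (y ` V)"
    have p: "p \<in> y ` V" "\<And>v. v \<in> V \<Longrightarrow> y v \<le> p"
      using psubset.hyps False by (auto simp: p_def)
    define W where "W = {v \<in> V. y v \<le> p - 1}"
    have "W \<subset> V" using p unfolding W_def by force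
    from psubset.IH[OF this] obtain P where P: "finite P" "P \<subseteq> y ` W"
      "\<forall>v\<in>W. \<exists>p\<in>P. y v \<le> p \<and> p < y v + 1" "\<forall>p\<in>P. \<forall>q\<in>P. p \<noteq> q \<longrightarrow> 1 \<le> \<bar>p - q\<bar>"
      by blast
    have low: "q \<le> p - 1" if "q \<in> P" for q
      using P(2) that by (auto simp: W_def)
    have "\<exists>q\<in>insert p P. y v \<le> q \<and> q < y v + 1" if "v \<in> V" for v
    proof (cases "v \<in> W")
      case True
      then show ?thesis using P(3) by blast
    next
      case False
      then show ?thesis using p(2)[OF that] that by (auto simp: W_def)
    qed
    moreover have "\<forall>q\<in>insert p P. \<forall>r\<in>insert p P. q \<noteq> r \<longrightarrow> 1 \<le> \<bar>q - r\<bar>"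
      using P(4) low by force
    moreover have "insert p P \<subseteq> y ` V" using p P(2) by (auto simp: W_def)
    ultimately show ?thesis using P(1) by (intro exI[of _ "insert p P"]) blast
  qed
qed

section \<open>Rows of the sweep and their consecutive pairs\<close>

text \<open>
  Squares are given by their lower left corners. Rows use half-open squares, so that the row at
  height \<open>t\<close> is the one seen just above \<open>t\<close> and no general position assumption is needed.
  In \<open>consecutive\<close>, \<open>None\<close> stands for the point at infinity on the respective side.
\<close>

locale separated_unit_squares =
  fixes V :: "'a set" and x y :: "'a \<Rightarrow> real"
  assumes finite_V: "finite V"
    and separated: "\<lbrakk>v \<in> V; w \<in> V; v \<noteq> w\<rbrakk> \<Longrightarrow> 1 \<le> \<bar>x v - x w\<bar> \<or> 1 \<le> \<bar>y v - y w\<bar>"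
begin

definition row_at :: "real \<Rightarrow> 'a set" where
  "row_at t = {v \<in> V. y v \<le> t \<and> t < y v + 1}"

text \<open>Closed at the other end, this is the row seen just below \<open>t\<close>. A square only
  in \<open>row_at t\<close> has its bottom at \<open>t\<close>, and one only in
  \<open>row_below t\<close> has its top there.\<close>

definition row_below :: "real \<Rightarrow> 'a set" where
  "row_below t = {v \<in> V. y v < t \<and> t \<le> y v + 1}"

definition lpos :: "'a option \<Rightarrow> ereal" where
  "lpos i = (case i of None \<Rightarrow> -\<infinity> | Some v \<Rightarrow> ereal (x v))"

definition rpos :: "'a option \<Rightarrow> ereal" where
  "rpos j = (case j of None \<Rightarrow> \<infinity> | Some v \<Rightarrow> ereal (x v))"

lemma pos_simps [simp]:
  "lpos None = -\<infinity>" "lpos (Some v) = ereal (x v)" "rpos None = \<infinity>" "rpos (Some v) = ereal (x v)"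
  by (simp_all add: lpos_def rpos_def)

definition consecutive :: "'a set \<Rightarrow> 'a option \<Rightarrow> 'a option \<Rightarrow> bool" where
  "consecutive R i j \<longleftrightarrow> set_option i \<subseteq> R \<and> set_option j \<subseteq> R \<and> lpos i < rpos j \<and>
     (\<forall>u\<in>R. \<not> (lpos i < ereal (x u) \<and> ereal (x u) < rpos j))"

definition pairs :: "('a option \<times> 'a option) set" where
  "pairs = {(i, j). \<exists>t. consecutive (row_at t) i j}"

definition adjacent_pairs :: "('a \<times> 'a) set" where
  "adjacent_pairs = {(v, w). (Some v, Some w) \<in> pairs}"

lemma row_subset: "row_at t \<subseteq> V"
  by (auto simp: row_at_def)

text \<open>Bottoms in one row differ by less than 1, so distinct squares must be separated in the
  \<open>x\<close> direction.\<close>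

lemma x_inj_row:
  assumes "v \<in> row_at t" "w \<in> row_at t" "x v = x w"
  shows "v = w"
  using separated[of v w] assms by (force simp: row_at_def)

lemma consecutive_empty: "consecutive {} i j \<longleftrightarrow> i = None \<and> j = None"
  by (cases i; cases j) (auto simp: consecutive_def)

text \<open>The nearer of two different right ends would be a square strictly between
  \<open>i\<close> and the farther one.\<close>

lemma consecutive_right_unique:
  assumes "consecutive (row_at t) i j" "consecutive (row_at t) i j'"
  shows "j = j'"
proof -
  have "rpos j = rpos j'"
  proof (rule ccontr)
    assume "rpos j \<noteq> rpos j'"
    then consider "rpos j < rpos j'" | "rpos j' < rpos j" by (meson linorder_neqE)
    then show False
      using assms by cases (cases j; cases j'; auto simp: consecutive_def)+
  qed
  then show ?thesis
    using assms x_inj_row by (cases j; cases j') (auto simp: consecutive_def)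
qed

lemma consecutive_left_unique:
  assumes "consecutive (row_at t) i j" "consecutive (row_at t) i' j"
  shows "i = i'"
proof -
  have "lpos i = lpos i'"
  proof (rule ccontr)
    assume "lpos i \<noteq> lpos i'"
    then consider "lpos i < lpos i'" | "lpos i' < lpos i" by (meson linorder_neqE)
    then show False
      using assms by cases (cases i; cases i'; auto simp: consecutive_def)+
  qed
  then show ?thesis
    using assms x_inj_row by (cases i; cases i') (auto simp: consecutive_def)
qed

text \<open>If two gaps contain \<open>a\<close> and their left ends differ, the left end farther
  right is a square of the row inside the other gap.\<close>

lemma consecutive_around_unique:
  assumes "consecutive (row_at t) i j" "consecutive (row_at t) i' j'"
    and "lpos i < ereal a" "ereal a < rpos j" "lpos i' < ereal a" "ereal a < rpos j'"
  shows "i = i'" "j = j'"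
proof -
  have not_less: "\<not> lpos k < lpos k'"
    if "consecutive (row_at t) k l" "consecutive (row_at t) k' l'"
      "ereal a < rpos l" "lpos k' < ereal a" for k l k' l'
  proof
    assume less: "lpos k < lpos k'"
    then obtain w where w: "k' = Some w" by (cases k') auto
    then have "w \<in> row_at t" using that(2) by (simp add: consecutive_def)
    moreover have "ereal (x w) < rpos l" using that(3,4) w by (metis pos_simps(2) less_trans)
    ultimately show False using that(1) less w by (simp add: consecutive_def)
  qed
  have "lpos i = lpos i'"
    using not_less[of i j i' j'] not_less[of i' j' i j] assms by (metis linorder_neqE)
  then show "i = i'"
    using assms x_inj_row by (cases i; cases i') (auto simp: consecutive_def)
  with assms show "j = j'" using consecutive_right_unique by blast
qed

section \<open>Heights at which rows change\<close>

text \<open>Rows change only at bottoms and tops, so \<open>t\<close> can be lowered to the nearest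
  such height. A square in the row guarantees that one exists.\<close>

lemma row_eq_row_critical:
  assumes "row_at t \<noteq> {}"
  shows "\<exists>c\<in>y ` V \<union> (\<lambda>v. y v + 1) ` V. row_at t = row_at c"
proof -
  define C where "C = {c \<in> y ` V \<union> (\<lambda>v. y v + 1) ` V. c \<le> t}"
  have fin: "finite C" using finite_V by (simp add: C_def)
  have "C \<noteq> {}" using assms by (auto simp: C_def row_at_def)
  then have M: "Max C \<in> C" "\<And>c. c \<in> C \<Longrightarrow> c \<le> Max C" using fin by auto
  have "Max C \<le> t" using M(1) by (simp add: C_def)
  have "v \<in> row_at t \<longleftrightarrow> v \<in> row_at (Max C)" if "v \<in> V" for v
    using that M(2)[of "y v"] M(2)[of "y v + 1"] \<open>Max C \<le> t\<close> by (force simp: row_at_def C_def)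
  then have "row_at t = row_at (Max C)" using row_subset by blast
  then show ?thesis using M(1) by (auto simp: C_def)
qed

lemma row_below_eq_row:
  "row_below t = {} \<or> (\<exists>c\<in>y ` V \<union> (\<lambda>v. y v + 1) ` V. c < t \<and> row_below t = row_at c)"
proof (rule disjCI)
  assume ne: "\<not> (\<exists>c\<in>y ` V \<union> (\<lambda>v. y v + 1) ` V. c < t \<and> row_below t = row_at c)"
  define C where "C = {c \<in> y ` V \<union> (\<lambda>v. y v + 1) ` V. c < t}"
  have fin: "finite C" using finite_V by (simp add: C_def)
  show "row_below t = {}"
  proof (cases "C = {}")
    case True
    then show ?thesis by (auto simp: C_def row_below_def)
  next
    case False
    then have M: "Max C \<in> C" "\<And>c. c \<in> C \<Longrightarrow> c \<le> Max C" using fin by auto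
    have "Max C < t" using M(1) by (simp add: C_def)
    have "v \<in> row_below t \<longleftrightarrow> v \<in> row_at (Max C)" if "v \<in> V" for v
      using that M(2)[of "y v"] M(2)[of "y v + 1"] \<open>Max C < t\<close>
      by (force simp: row_at_def row_below_def C_def)
    then have "row_below t = row_at (Max C)" by (auto simp: row_at_def row_below_def)
    then show ?thesis using ne M(1) by (auto simp: C_def)
  qed
qed

text \<open>Take the lowest critical height \<open>k\<close> showing the pair. The row just below
  \<open>k\<close> is empty or equals the row at a lower critical height, and an empty row shows
  only \<open>(None, None)\<close>.\<close>

lemma pairs_first_level:
  assumes "(i, j) \<in> pairs" "(i, j) \<noteq> (None, None)"
  shows "\<exists>k. consecutive (row_at k) i j \<and> \<not> consecutive (row_below k) i j"
proof -
  define K where "K = {c \<in> y ` V \<union> (\<lambda>v. y v + 1) ` V. consecutive (row_at c) i j}"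
  have fin: "finite K" using finite_V by (simp add: K_def)
  obtain t where t: "consecutive (row_at t) i j" using assms(1) by (auto simp: pairs_def)
  then have "row_at t \<noteq> {}" using assms(2) consecutive_empty by auto
  then have "K \<noteq> {}" using row_eq_row_critical[of t] t by (auto simp: K_def)
  then have M: "Min K \<in> K" "\<And>c. c \<in> K \<Longrightarrow> Min K \<le> c" using fin by auto
  have "\<not> consecutive (row_below (Min K)) i j"
    using row_below_eq_row[of "Min K"]
  proof
    assume "row_below (Min K) = {}"
    then show ?thesis using assms(2) by (simp add: consecutive_empty)
  next
    assume "\<exists>c\<in>y ` V \<union> (\<lambda>v. y v + 1) ` V. c < Min K \<and> row_below (Min K) = row_at c"
    then obtain c where c: "c \<in> y ` V \<union> (\<lambda>v. y v + 1) ` V" "c < Min K"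
      "row_below (Min K) = row_at c"
      by blast
    then have "c \<notin> K" using M(2) by fastforce
    then have "\<not> consecutive (row_at c) i j" using c(1) unfolding K_def by blast
    then show ?thesis unfolding c(3) .
  qed
  then show ?thesis using M(1) by (auto simp: K_def)
qed

section \<open>Events that create pairs\<close>

datatype event = Left_Bottom | Right_Bottom | Separator_Top

text \<open>An event records that the pair is present just above its height and how \<open>v\<close>
  lies relative to the pair; this already determines the pair.\<close>

definition creates :: "'a \<times> event \<Rightarrow> 'a option \<times> 'a option \<Rightarrow> bool" where
  "creates z b = (case (z, b) of ((v, e), (i, j)) \<Rightarrow> (case e of
     Left_Bottom \<Rightarrow> i = Some v \<and> consecutive (row_at (y v)) i j
   | Right_Bottom \<Rightarrow> j = Some v \<and> consecutive (row_at (y v)) i j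
   | Separator_Top \<Rightarrow> consecutive (row_at (y v + 1)) i j \<and> lpos i < ereal (x v) \<and> ereal (x v) < rpos j))"

lemma creates_unique:
  assumes "creates z b" "creates z b'"
  shows "b = b'"
proof -
  obtain v e i j i' j' where z: "z = (v, e)" "b = (i, j)" "b' = (i', j')"
    by (cases z; cases b; cases b')
  show ?thesis
  proof (cases e)
    case Left_Bottom
    then show ?thesis
      using assms consecutive_right_unique unfolding z creates_def by auto
  next
    case Right_Bottom
    then show ?thesis
      using assms consecutive_left_unique unfolding z creates_def by auto
  next
    case Separator_Top
    then show ?thesis
      using assms consecutive_around_unique[of "y v + 1" i j i' j' "x v"]
      unfolding z creates_def by auto
  qed
qed

lemma pairs_created:
  assumes "(i, j) \<in> pairs" "(i, j) \<noteq> (None, None)"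
  shows "\<exists>v\<in>V. \<exists>e. creates (v, e) (i, j)"
proof -
  obtain k where k: "consecutive (row_at k) i j" "\<not> consecutive (row_below k) i j"
    using pairs_first_level[OF assms] by blast
  \<comment> \<open>The order of the two ends does not depend on the row, so the pair can be missing
    below \<open>k\<close> only because an end is missing there or a square separates the
    ends.\<close>
  then consider v where "i = Some v" "v \<in> row_at k" "v \<notin> row_below k"
    | w where "j = Some w" "w \<in> row_at k" "w \<notin> row_below k"
    | u where "u \<in> row_below k" "lpos i < ereal (x u)" "ereal (x u) < rpos j" "u \<notin> row_at k"
    by (cases i; cases j) (auto simp: consecutive_def)
  then show ?thesis
  proof cases
    case 1
    then have "y v = k" "v \<in> V" by (auto simp: row_at_def row_below_def)
    then have "creates (v, Left_Bottom) (i, j)" using 1 k by (simp add: creates_def)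
    then show ?thesis using \<open>v \<in> V\<close> by blast
  next
    case 2
    then have "y w = k" "w \<in> V" by (auto simp: row_at_def row_below_def)
    then have "creates (w, Right_Bottom) (i, j)" using 2 k by (simp add: creates_def)
    then show ?thesis using \<open>w \<in> V\<close> by blast
  next
    case 3
    then have "y u + 1 = k" "u \<in> V" by (auto simp: row_at_def row_below_def)
    then have "creates (u, Separator_Top) (i, j)" using 3 k by (simp add: creates_def)
    then show ?thesis using \<open>u \<in> V\<close> by blast
  qed
qed

section \<open>Counting the pairs of one sweep\<close>

lemma UNIV_event: "(UNIV :: event set) = {Left_Bottom, Right_Bottom, Separator_Top}"
  using event.exhaust by auto

lemma card_pairs_less:
  assumes "V \<noteq> {}"
  shows "card (pairs - {(None, None)}) < 3 * card V"
proof -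
  obtain u where u: "u \<in> V" "\<And>v. v \<in> V \<Longrightarrow> y v \<le> y u"
    using obtains_MAX[OF finite_V assms, of y] finite_V by (metis Max_ge finite_imageI imageI)
  \<comment> \<open>Rows exclude tops, so nothing remains at the highest top. The event there can
    create only \<open>(None, None)\<close>, which makes the bound strict.\<close>
  have "row_at (y u + 1) = {}" using u(2) by (force simp: row_at_def)
  then have top: "\<not> creates (u, Separator_Top) (i, j)" if "(i, j) \<noteq> (None, None)" for i j
    using that by (auto simp: creates_def consecutive_empty)
  define Z where "Z = V \<times> UNIV - {(u, Separator_Top)}"
  have fin: "finite (V \<times> (UNIV :: event set))" using finite_V by (simp add: UNIV_event)
  have "card (pairs - {(None, None)}) \<le> card Z"
  proof (rule card_le_if_inj_on_rel[where r = "\<lambda>b z. creates z b"])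
    show "finite Z" using fin by (simp add: Z_def)
  next
    fix b assume "b \<in> pairs - {(None, None)}"
    then obtain i j where b: "b = (i, j)" "(i, j) \<in> pairs" "(i, j) \<noteq> (None, None)"
      by (cases b) auto
    then obtain v e where ve: "v \<in> V" "creates (v, e) (i, j)" using pairs_created by blast
    then have "(v, e) \<noteq> (u, Separator_Top)" using top[OF b(3)] by auto
    then have "(v, e) \<in> Z" using ve(1) by (simp add: Z_def)
    then show "\<exists>z. z \<in> Z \<and> creates z b" using ve(2) b(1) by blast
  qed (use creates_unique in blast)
  also have "\<dots> < card (V \<times> (UNIV :: event set))"
    unfolding Z_def by (rule psubset_card_mono[OF fin]) (use u(1) in auto)
  also have "\<dots> = 3 * card V" by (simp add: card_cartesian_product UNIV_event)
  finally show ?thesis .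
qed

lemma finite_pairs: "finite pairs"
proof (rule finite_subset)
  show "pairs \<subseteq> insert None (Some ` V) \<times> insert None (Some ` V)"
  proof
    fix b assume "b \<in> pairs"
    then obtain i j where "b = (i, j)" "set_option i \<subseteq> V" "set_option j \<subseteq> V"
      using row_subset by (fastforce simp: pairs_def consecutive_def)
    then show "b \<in> insert None (Some ` V) \<times> insert None (Some ` V)"
      by (cases i; cases j) auto
  qed
qed (use finite_V in simp)

lemma row_leftmost:
  assumes "row_at t \<noteq> {}"
  shows "\<exists>v\<in>row_at t. (None, Some v) \<in> pairs"
proof -
  have fin: "finite (row_at t)" using finite_V row_subset finite_subset by blast
  obtain v where "v \<in> row_at t" "\<And>u. u \<in> row_at t \<Longrightarrow> x v \<le> x u"
    using obtains_MIN[OF fin assms, of x] fin by (metis Min_le finite_imageI imageI)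
  then have "consecutive (row_at t) None (Some v)"
    by (force simp: consecutive_def)
  then show ?thesis using \<open>v \<in> row_at t\<close> by (auto simp: pairs_def)
qed

lemma row_rightmost:
  assumes "row_at t \<noteq> {}"
  shows "\<exists>v\<in>row_at t. (Some v, None) \<in> pairs"
proof -
  have fin: "finite (row_at t)" using finite_V row_subset finite_subset by blast
  obtain v where "v \<in> row_at t" "\<And>u. u \<in> row_at t \<Longrightarrow> x u \<le> x v"
    using obtains_MAX[OF fin assms, of x] fin by (metis Max_ge finite_imageI imageI)
  then have "consecutive (row_at t) (Some v) None"
    by (force simp: consecutive_def)
  then show ?thesis using \<open>v \<in> row_at t\<close> by (auto simp: pairs_def)
qed

text \<open>Rows at heights in \<open>P\<close> are pairwise disjoint, so their leftmost squares are
  distinct, as are their rightmost ones. This yields \<open>2 * card P\<close> pairs with exactly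
  one end at infinity, to be subtracted from the total.\<close>

lemma card_adjacent_pairs:
  assumes "V \<noteq> {}" and P: "P \<subseteq> y ` V" "\<forall>p\<in>P. \<forall>q\<in>P. p \<noteq> q \<longrightarrow> 1 \<le> \<bar>p - q\<bar>"
  shows "finite adjacent_pairs" "card adjacent_pairs + 2 * card P + 1 \<le> 3 * card V"
proof -
  have disj: "p = q" if "p \<in> P" "q \<in> P" "v \<in> row_at p" "v \<in> row_at q" for p q v
    using P(2) that by (force simp: row_at_def)
  \<comment> \<open>Each \<open>p\<close> is the bottom of some square, which belongs to the row at
    \<open>p\<close>.\<close>
  have ne: "row_at p \<noteq> {}" if "p \<in> P" for p using P(1) that by (force simp: row_at_def)
  define A where "A = (\<lambda>(v, w). (Some v, Some w)) ` adjacent_pairs"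
  define L where "L = {b \<in> pairs. \<exists>v. b = (None, Some v)}"
  define R where "R = {b \<in> pairs. \<exists>v. b = (Some v, None)}"
  have sub: "A \<subseteq> pairs" "L \<subseteq> pairs" "R \<subseteq> pairs"
    by (auto simp: A_def L_def R_def adjacent_pairs_def)
  then have fin: "finite A" "finite L" "finite R"
    using finite_pairs finite_subset by blast+
  have inj: "inj_on (\<lambda>(v, w). (Some v, Some w)) adjacent_pairs" by (auto simp: inj_on_def)
  then show "finite adjacent_pairs" using fin(1) unfolding A_def by (rule finite_imageD[rotated])
  have cA: "card A = card adjacent_pairs" unfolding A_def by (rule card_image[OF inj])
  have cL: "card P \<le> card L"
  proof (rule card_le_if_inj_on_rel[where r = "\<lambda>p b. \<exists>v\<in>row_at p. b = (None, Some v)"])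
    fix p assume "p \<in> P"
    then show "\<exists>b. b \<in> L \<and> (\<exists>v\<in>row_at p. b = (None, Some v))"
      using row_leftmost[OF ne] by (fastforce simp: L_def)
  qed (use fin disj in auto)
  have cR: "card P \<le> card R"
  proof (rule card_le_if_inj_on_rel[where r = "\<lambda>p b. \<exists>v\<in>row_at p. b = (Some v, None)"])
    fix p assume "p \<in> P"
    then show "\<exists>b. b \<in> R \<and> (\<exists>v\<in>row_at p. b = (Some v, None))"
      using row_rightmost[OF ne] by (fastforce simp: R_def)
  qed (use fin disj in auto)
  have "card A + card L + card R = card (A \<union> L \<union> R)"
  proof -
    have "A \<inter> L = {}" "(A \<union> L) \<inter> R = {}" by (auto simp: A_def L_def R_def)
    then show ?thesis using fin by (simp add: card_Un_disjoint)
  qed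
  also have "\<dots> \<le> card (pairs - {(None, None)})"
    by (rule card_mono) (use finite_pairs sub in \<open>auto simp: A_def L_def R_def\<close>)
  finally show "card adjacent_pairs + 2 * card P + 1 \<le> 3 * card V"
    using card_pairs_less[OF assms(1)] cA cL cR by linarith
qed

end

section \<open>From visibility bands to consecutive pairs\<close>

lemma interior_unit_square:
  fixes p :: "real \<times> real"
  shows "interior (cbox p (p + (1, 1))) =
    {q. fst p < fst q \<and> fst q < fst p + 1 \<and> snd p < snd q \<and> snd q < snd p + 1}"
  by (cases p) (auto simp: cbox_Pair_eq interior_Times)

text \<open>Abstract coordinates \<open>f\<close> and \<open>g\<close> serve both directions. Bands
  are symmetric but pairs are ordered by position, hence the two candidates in the
  conclusion.\<close>

lemma visibility_band_adjacent_pairs: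
  fixes f g :: "real \<times> real \<Rightarrow> real"
  assumes "separated_unit_squares V (f \<circ> p) (g \<circ> p)"
    and surj: "\<And>a b. \<exists>q. f q = a \<and> g q = b"
    and mem: "\<And>v q. v \<in> V \<Longrightarrow>
      q \<in> S v \<longleftrightarrow> f (p v) \<le> f q \<and> f q \<le> f (p v) + 1 \<and> g (p v) \<le> g q \<and> g q \<le> g (p v) + 1"
    and int: "\<And>v q. v \<in> V \<Longrightarrow> q \<in> interior (S v) \<longleftrightarrow>
      f (p v) < f q \<and> f q < f (p v) + 1 \<and> g (p v) < g q \<and> g q < g (p v) + 1"
    and vw: "v \<in> V" "w \<in> V" "v \<noteq> w"
    and band: "visibility_band f g V S v w"
  shows "{(v, w), (w, v)} \<inter> separated_unit_squares.adjacent_pairs V (f \<circ> p) (g \<circ> p) \<noteq> {}"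
proof -
  interpret separated_unit_squares V "f \<circ> p" "g \<circ> p" by fact
  obtain c d where cd: "c < d" and vis: "\<And>t. t \<in> {c<..<d} \<Longrightarrow>
     (\<exists>q\<in>interior (S v). g q = t) \<and> (\<exists>q\<in>interior (S w). g q = t) \<and>
     (\<forall>u\<in>V - {v, w}. gap f g t (S v) (S w) \<inter> interior (S u) = {})"
    using band unfolding visibility_band_def by blast
  \<comment> \<open>Avoiding the finitely many bottoms ensures that the line at \<open>t\<close>
    meets every square of \<open>row_at t\<close> in its interior.\<close>
  have "infinite ({c<..<d} - (g \<circ> p) ` V)" using cd finite_V by (simp add: infinite_Ioo)
  then obtain t where t: "t \<in> {c<..<d}" "t \<notin> (g \<circ> p) ` V"
    by (metis Diff_iff all_not_in_conv finite.emptyI)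
  have row: "g (p u) < t \<and> t < g (p u) + 1" if "u \<in> row_at t" for u
    using that t(2) by (force simp: row_at_def)
  have in_row: "v \<in> row_at t" "w \<in> row_at t"
    using vis[OF t(1)] vw int by (auto simp: row_at_def less_imp_le)
  have apart: "1 \<le> \<bar>f (p u) - f (p u')\<bar>" if "u \<in> row_at t" "u' \<in> row_at t" "u \<noteq> u'" for u u'
    using separated[of u u'] that by (force simp: row_at_def)
  have free: "\<not> (min (f (p v)) (f (p w)) < f (p u) \<and> f (p u) < max (f (p v)) (f (p w)))"
    if u: "u \<in> row_at t" for u
  proof
    assume btw: "min (f (p v)) (f (p w)) < f (p u) \<and> f (p u) < max (f (p v)) (f (p w))"
    then have uV: "u \<in> V - {v, w}" using u row_subset by auto
    \<comment> \<open>The midpoint of the chord of \<open>S u\<close>. Since \<open>u\<close> is at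
      distance at least 1 from \<open>v\<close> and from \<open>w\<close> along the line, the whole
      chord lies in the gap.\<close>
    obtain q where q: "f q = f (p u) + 1/2" "g q = t" using surj by blast
    have "q \<in> interior (S u)" using int[of u q] uV q row[OF u] by auto
    moreover have "q \<in> gap f g t (S v) (S w)"
      using apart[OF u in_row(1)] apart[OF u in_row(2)] uV btw q vw
      unfolding gap_def by (auto simp: mem min_def max_def split: if_splits)
    ultimately show False using vis[OF t(1)] uV by blast
  qed
  have "f (p v) \<noteq> f (p w)" using apart[OF in_row vw(3)] by auto
  then consider "f (p v) < f (p w)" | "f (p w) < f (p v)" by linarith
  then have "consecutive (row_at t) (Some v) (Some w) \<or> consecutive (row_at t) (Some w) (Some v)"
    using in_row free by cases (auto simp: consecutive_def)
  then show ?thesis by (auto simp: adjacent_pairs_def pairs_def)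
qed

section \<open>Grid points and the final count\<close>

text \<open>Each half-open square contains a point of the grid of stabbing lines; two squares
  sharing one would differ by less than 1 in both coordinates.\<close>

lemma card_le_card_stabbing_sets:
  assumes "separated_unit_squares V x y" "finite P" "finite Q"
    and P: "\<forall>v\<in>V. \<exists>p\<in>P. y v \<le> p \<and> p < y v + 1"
    and Q: "\<forall>v\<in>V. \<exists>q\<in>Q. x v \<le> q \<and> q < x v + 1"
  shows "card V \<le> card P * card Q"
proof -
  interpret separated_unit_squares V x y by fact
  have "card V \<le> card (P \<times> Q)"
  proof (rule card_le_if_inj_on_rel[where r = "\<lambda>v (p, q).
      y v \<le> p \<and> p < y v + 1 \<and> x v \<le> q \<and> q < x v + 1"])
    fix v w b assume "v \<in> V" "w \<in> V"
      "case b of (p, q) \<Rightarrow> y v \<le> p \<and> p < y v + 1 \<and> x v \<le> q \<and> q < x v + 1"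
      "case b of (p, q) \<Rightarrow> y w \<le> p \<and> p < y w + 1 \<and> x w \<le> q \<and> q < x w + 1"
    then show "v = w" using separated[of v w] by (cases b) force
  qed (use assms in \<open>auto, blast\<close>)
  then show ?thesis by (simp add: card_cartesian_product)
qed

text \<open>Otherwise \<open>a + b\<close> is at most \<open>2 * (k - 1)\<close> for the ceiling
  \<open>k\<close>, and the inequality of arithmetic and geometric means gives \<open>a * b\<close>
  at most \<open>(k - 1)\<^sup>2\<close>, which is less than \<open>n\<close>.\<close>

lemma two_ceiling_sqrt_le:
  fixes a b n :: nat
  assumes "n \<ge> 1" "n \<le> a * b"
  shows "2 * \<lceil>sqrt (real n)\<rceil> \<le> int a + int b + 1"
proof (rule ccontr)
  define k where "k = \<lceil>sqrt (real n)\<rceil>"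
  assume "\<not> ?thesis"
  then have ab: "int a + int b \<le> 2 * (k - 1)" by (simp add: k_def)
  have "real_of_int (k - 1) < sqrt (real n)" unfolding k_def by linarith
  \<comment> \<open>Needed for squaring the strict inequality; it follows from \<open>a + b\<close>
    being nonnegative.\<close>
  moreover have "0 \<le> k - 1" using ab by presburger
  ultimately have "(real_of_int (k - 1))\<^sup>2 < (sqrt (real n))\<^sup>2"
    by (intro power_strict_mono) auto
  then have "real_of_int ((k - 1)\<^sup>2) < real_of_int (int n)" by simp
  then have "(k - 1)\<^sup>2 < int n" by (simp only: of_int_less_iff)
  also have "\<dots> \<le> int a * int b" using assms(2) by (metis of_nat_le_iff of_nat_mult)
  finally have "4 * (k - 1)\<^sup>2 < 4 * (int a * int b)" by simp
  also have "\<dots> \<le> (int a + int b)\<^sup>2"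
    using zero_le_power2[of "int a - int b"] by (simp add: power2_eq_square algebra_simps)
  also have "\<dots> \<le> (2 * (k - 1))\<^sup>2" by (rule power_mono[OF ab]) simp
  finally show False by (simp add: power2_eq_square algebra_simps)
qed

theorem theorem6p4:
  fixes V :: "'a set" and E :: "'a set set" and n :: nat
  assumes "n \<ge> 1"
    and "unit_rectangle_visibility_graph V E"
    and "card V = n"
  shows "int (card E) \<le> 6 * int n - 4 * \<lceil>sqrt (real n)\<rceil> + 1"
proof -
  have E: "E \<subseteq> {e. e \<subseteq> V \<and> card e = 2}" and finV: "finite V"
    using assms(2) by (auto simp: unit_rectangle_visibility_graph_def simple_graph_def)
  have "V \<noteq> {}" using assms by auto
  obtain S where rep: "urv_representation V E S"
    using assms(2) by (auto simp: unit_rectangle_visibility_graph_def)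
  have disj: "disjoint_family_on (\<lambda>v. interior (S v)) V"
    using rep by (simp add: urv_representation_def)
  have adj: "horizontal_band V S v w \<or> vertical_band V S v w"
    if "v \<in> V" "w \<in> V" "v \<noteq> w" "{v, w} \<in> E" for v w
    using rep that by (simp add: urv_representation_def)
  have "\<forall>v\<in>V. \<exists>p. S v = cbox p (p + (1, 1))"
    using rep by (simp add: urv_representation_def unit_square_def)
  from bchoice[OF this] obtain p where p: "\<And>v. v \<in> V \<Longrightarrow> S v = cbox (p v) (p v + (1, 1))"
    by blast
  have mem: "q \<in> S v \<longleftrightarrow> fst (p v) \<le> fst q \<and> fst q \<le> fst (p v) + 1 \<and>
      snd (p v) \<le> snd q \<and> snd q \<le> snd (p v) + 1" if "v \<in> V" for v q
    unfolding p[OF that] by (cases "p v"; cases q) (auto simp: cbox_Pair_eq)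
  have int: "q \<in> interior (S v) \<longleftrightarrow> fst (p v) < fst q \<and> fst q < fst (p v) + 1 \<and>
      snd (p v) < snd q \<and> snd q < snd (p v) + 1" if "v \<in> V" for v q
    unfolding p[OF that] interior_unit_square by simp
  define x y where "x = fst \<circ> p" and "y = snd \<circ> p"
  have sep: "1 \<le> \<bar>x v - x w\<bar> \<or> 1 \<le> \<bar>y v - y w\<bar>" if "v \<in> V" "w \<in> V" "v \<noteq> w" for v w
  proof (rule ccontr)
    assume close: "\<not> ?thesis"
    \<comment> \<open>The midpoint of the two centres, interior to both squares when both coordinate
      differences are below 1.\<close>
    define q where "q = ((x v + x w + 1) / 2, (y v + y w + 1) / 2)"
    have "q \<in> interior (S v)" "q \<in> interior (S w)"
      using that close unfolding int[OF that(1)] int[OF that(2)]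
      by (auto simp: q_def x_def y_def abs_le_iff not_le abs_less_iff)
    then show False using disj that by (auto simp: disjoint_family_on_def)
  qed
  interpret H: separated_unit_squares V x y
    using finV sep by unfold_locales
  \<comment> \<open>Exchanging the coordinates turns vertical visibility into the horizontal
    case.\<close>
  interpret W: separated_unit_squares V y x
  proof
    show "1 \<le> \<bar>y v - y w\<bar> \<or> 1 \<le> \<bar>x v - x w\<bar>" if "v \<in> V" "w \<in> V" "v \<noteq> w" for v w
      using sep[OF that] by blast
  qed (fact finV)
  obtain P where P: "finite P" "P \<subseteq> y ` V" "\<forall>v\<in>V. \<exists>p\<in>P. y v \<le> p \<and> p < y v + 1"
    "\<forall>p\<in>P. \<forall>q\<in>P. p \<noteq> q \<longrightarrow> 1 \<le> \<bar>p - q\<bar>"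
    using separated_stabbing_set[OF finV, of y] by blast
  obtain Q where Q: "finite Q" "Q \<subseteq> x ` V" "\<forall>v\<in>V. \<exists>p\<in>Q. x v \<le> p \<and> p < x v + 1"
    "\<forall>p\<in>Q. \<forall>q\<in>Q. p \<noteq> q \<longrightarrow> 1 \<le> \<bar>p - q\<bar>"
    using separated_stabbing_set[OF finV, of x] by blast
  note cH = H.card_adjacent_pairs[OF \<open>V \<noteq> {}\<close> P(2,4)]
  note cW = W.card_adjacent_pairs[OF \<open>V \<noteq> {}\<close> Q(2,4)]
  define F where "F = H.adjacent_pairs \<union> W.adjacent_pairs"
  have "E \<subseteq> (\<lambda>(v, w). {v, w}) ` F"
  proof
    fix e assume e: "e \<in> E"
    then obtain v w where vw: "e = {v, w}" "v \<noteq> w" "v \<in> V" "w \<in> V"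
      using E by (auto simp: card_2_iff)
    then have "horizontal_band V S v w \<or> vertical_band V S v w"
      using adj e by blast
    then have "{(v, w), (w, v)} \<inter> F \<noteq> {}"
    proof
      assume b: "horizontal_band V S v w"
      have "{(v, w), (w, v)} \<inter> H.adjacent_pairs \<noteq> {}"
        unfolding x_def y_def
        by (rule visibility_band_adjacent_pairs[where S = S])
          (use b vw mem int H.separated_unit_squares_axioms in \<open>auto simp: x_def y_def\<close>)
      then show ?thesis by (auto simp: F_def)
    next
      assume b: "vertical_band V S v w"
      have "{(v, w), (w, v)} \<inter> W.adjacent_pairs \<noteq> {}"
        unfolding x_def y_def
        by (rule visibility_band_adjacent_pairs[where S = S])
          (use b vw mem int W.separated_unit_squares_axioms in \<open>auto simp: x_def y_def\<close>)
      then show ?thesis by (auto simp: F_def)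
    qed
    then show "e \<in> (\<lambda>(v, w). {v, w}) ` F" using vw(1) by (auto simp: insert_commute)
  qed
  moreover have "finite F" using cH(1) cW(1) by (simp add: F_def)
  ultimately have "card E \<le> card F" by (rule surj_card_le[rotated])
  \<comment> \<open>An edge visible in both directions may be counted twice here.\<close>
  also have "\<dots> \<le> card H.adjacent_pairs + card W.adjacent_pairs"
    unfolding F_def by (rule card_Un_le)
  finally have edges: "card E + 2 * (card P + card Q) + 2 \<le> 6 * n"
    using cH(2) cW(2) unfolding assms(3) by presburger
  have "n \<le> card P * card Q"
    using card_le_card_stabbing_sets[OF H.separated_unit_squares_axioms P(1) Q(1) P(3) Q(3)]
    unfolding assms(3) .
  then have "2 * \<lceil>sqrt (real n)\<rceil> \<le> int (card P) + int (card Q) + 1"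
    by (rule two_ceiling_sqrt_le[OF assms(1)])
  \<comment> \<open>Twice \<open>card P + card Q\<close> is at least
    \<open>4 * \<lceil>sqrt (real n)\<rceil> - 2\<close>, and the 2 gained from the highest tops of
    both sweeps cancels the loss. The estimate is thus one better than claimed.\<close>
  with edges show ?thesis by presburger
qed

end
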